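(* Let $m\ge 2$, $n\ge1$ and let $A\colon\mathbb{N}^m\to\mathcal{M}_n(\mathbb{R})$ be such that $A(t)$ is invertible for all $t\in\mathbb{N}^m$. Suppose there exists an integer $T\ge 1$ such that $A(t+T\cdot{\bf 1})=A(t)$ for all $t\in\mathbb{N}^m$. Let $B\colon\mathbb{N}^m\to\mathcal{M}_n(\mathbb{C})$ be given by $B(t)=\widetilde{B}\big(t-\mu(t)\cdot{\bf 1}\big)$, where, for each $t\in\mathbb{N}^m$, $\widetilde{B}(t)\in\mathcal{M}_n(\mathbb{C})$ is a fixed (arbitrarily chosen) matrix with $\widetilde{B}(t)^T=\widetilde{A}(t)$ ($T$-th power). Let $P\colon\mathbb{N}^m\to\mathcal{M}_n(\mathbb{C})$ be the function determined by $\Phi(t)=P(t)B(t)^{\mu(t)}$ for all $t\in\mathbb{N}^m$, where $\Phi$ is the fundamental matrix of the recurrence $x(t+{\bf 1})=A(t)x(t)$. Consider the recurrences $$\text{(a)}\quad x(t+{\bf 1})=A(t)x(t),\quad\forall t\in\mathbb{N}^m;\qquad\qquad \text{(b)}\quad y(t+{\bf 1})=B(t)y(t),\quad\forall t\in\mathbb{N}^m,$$ for functions $x,y\colon\mathbb{N}^m\to\mathbb{C}^n$. If $y$ is a solution of (b), then $x(t):=P(t)y(t)$ is a solution of (a). Conversely, if $x$ is a solution of (a), then $y(t):=P(t)^{-1}x(t)$ is a solution of (b).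
   Context: $\mathbb{N}=\{0,1,2,\ldots\}$; $\mathcal{M}_n(K)$ is the set of $n\times n$ matrices over $K$. For $t=(t^1,\ldots,t^m)\in\mathbb{N}^m$, $\mu(t)=\min\{t^1,\ldots,t^m\}$, and ${\bf 1}=(1,\ldots,1)\in\mathbb{N}^m$. A superscript $T$ on a matrix denotes the $T$-th power (not the transpose). The fundamental matrix associated to the recurrence $x(t+{\bf 1})=A(t)x(t)$, $t\in\mathbb{N}^m$, is the function $\Phi\colon\mathbb{N}^m\to\mathcal{M}_n(\mathbb{R})$ defined by $\Phi(t)=A(t-{\bf 1})A(t-2\cdot{\bf 1})\cdots A(t-\mu(t)\cdot{\bf 1})$ if $\mu(t)\ge1$, and $\Phi(t)=I_n$ if $\mu(t)=0$. The function $\widetilde{A}\colon\mathbb{N}^m\to\mathcal{M}_n(\mathbb{R})$ is $\widetilde A(t)=A(t+(T-1)\cdot{\bf 1})A(t+(T-2)\cdot{\bf 1})\cdots A(t+{\bf 1})A(t)$. Since $\widetilde A(t)$ is invertible, a complex matrix $\widetilde B(t)$ with $\widetilde B(t)^T=\widetilde A(t)$ exists (it is not unique); one such matrix is fixed for each $t$, and it is invertible. Consequently $B(t)$ and $\Phi(t)$ are invertible for all $t$, so $P(t)=\Phi(t)B(t)^{-\mu(t)}$ is well defined and invertible. *)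

theory Defs
  imports "HOL-Analysis.Analysis"
begin

text \<open>Multi-times are elements of \<^typ>\<open>nat ^ 'm\<close>. There \<open>1\<close> is the all-ones vector and
  addition and subtraction are componentwise; subtraction truncates, but below only multiples
  \<open>k *s 1\<close> with \<open>k\<close> at most the minimum of the components of \<open>t\<close> are subtracted from \<open>t\<close>.\<close>

definition min_coord :: "nat ^ 'm \<Rightarrow> nat" where
  "min_coord t = Min (range (($) t))"

text \<open>The library operations \<open>*\<close> and \<open>^\<close> on \<^typ>\<open>'a ^ 'n ^ 'n\<close> act entrywise, hence the
  following two notions built on the matrix product \<open>**\<close>.\<close>

primrec mat_pow :: "'a::semiring_1 ^ 'n ^ 'n \<Rightarrow> nat \<Rightarrow> 'a ^ 'n ^ 'n" where
  "mat_pow M 0 = mat 1"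
| "mat_pow M (Suc k) = M ** mat_pow M k"

definition mat_prod_list :: "('a::semiring_1 ^ 'n ^ 'n) list \<Rightarrow> 'a ^ 'n ^ 'n" where
  "mat_prod_list Ms = foldr (**) Ms (mat 1)"

text \<open>\<open>A (t - 1) ** A (t - 2 *s 1) ** \<dots> ** A (t - min_coord t *s 1)\<close>, read as the identity
  matrix if \<open>min_coord t = 0\<close>.\<close>

definition fundamental_matrix ::
    "(nat ^ 'm \<Rightarrow> 'a::semiring_1 ^ 'n ^ 'n) \<Rightarrow> nat ^ 'm \<Rightarrow> 'a ^ 'n ^ 'n" where
  "fundamental_matrix A t = mat_prod_list (map (\<lambda>k. A (t - k *s 1)) [1..<Suc (min_coord t)])"

text \<open>\<open>A (t + (T - 1) *s 1) ** \<dots> ** A (t + 1) ** A t\<close>.\<close>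

definition monodromy_matrix ::
    "(nat ^ 'm \<Rightarrow> 'a::semiring_1 ^ 'n ^ 'n) \<Rightarrow> nat \<Rightarrow> nat ^ 'm \<Rightarrow> 'a ^ 'n ^ 'n" where
  "monodromy_matrix A T t = mat_prod_list (map (\<lambda>k. A (t + k *s 1)) (rev [0..<T]))"

abbreviation complex_matrix :: "real ^ 'n ^ 'k \<Rightarrow> complex ^ 'n ^ 'k" where
  "complex_matrix \<equiv> map_matrix complex_of_real"

definition solves_recurrence ::
    "(nat ^ 'm \<Rightarrow> 'a::semiring_1 ^ 'n ^ 'n) \<Rightarrow> (nat ^ 'm \<Rightarrow> 'a ^ 'n) \<Rightarrow> bool" where
  "solves_recurrence A x \<longleftrightarrow> (\<forall>t. x (t + 1) = A t *v x t)"

end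

theory Submission
  imports Defs
begin

text \<open>The matrices \<open>P\<close> intertwine the two recurrences: \<open>P (t + 1) ** B t = A t ** P t\<close>. Indeed
  \<open>B\<close> is constant along the direction of \<open>1\<close>, so both sides agree after multiplication by
  \<open>B t\<close> to the power \<open>min_coord t\<close>, by the recurrence for the fundamental matrix, and this power
  can be cancelled.\<close>

lemma min_coord_plus_1: "min_coord (t + 1) = Suc (min_coord t)" for t :: "nat ^ 'm"
proof -
  have "range (($) (t + 1)) = Suc ` range (($) t)"
    by (auto simp: image_def)
  then show ?thesis
    unfolding min_coord_def by (simp add: mono_Min_commute[of Suc] mono_Suc)
qed

text \<open>True for every \<open>k\<close>, as truncated subtraction satisfies
  \<open>Suc a - Suc k = a - k\<close> in each component. It serves both the fundamental matrix and
  the constancy of \<open>B\<close> along \<open>1\<close>.\<close>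

lemma plus_1_minus_Suc_smult_1: "t + 1 - Suc k *s 1 = t - k *s 1" for t :: "nat ^ 'm"
  by (simp add: vec_eq_iff)

lemma mat_prod_list_Cons: "mat_prod_list (M # Ms) = M ** mat_prod_list Ms"
  by (simp add: mat_prod_list_def)

text \<open>Factor \<open>k + 1\<close> of the product at \<open>t + 1\<close> is factor
  \<open>k\<close> of the product at \<open>t\<close>, so only one new factor appears, at the left
  end.\<close>

lemma fundamental_matrix_plus_1:
  "fundamental_matrix A (t + 1) = A t ** fundamental_matrix A t"
proof -
  \<comment> \<open>\<open>upt_Suc\<close> would split off the last index, whereas the new factor
    belongs to the first one.\<close>
  have "[1..<Suc (Suc (min_coord t))] = 1 # map Suc [1..<Suc (min_coord t)]"
    by (simp add: map_Suc_upt upt_conv_Cons del: upt_Suc)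
  moreover have "t + 1 - 1 *s 1 = t"
    by (simp add: vec_eq_iff)
  ultimately show ?thesis
    unfolding fundamental_matrix_def min_coord_plus_1
    by (simp add: mat_prod_list_Cons comp_def plus_1_minus_Suc_smult_1 del: upt_Suc)
qed

lemma invertible_mat_prod_list:
  assumes "\<And>M. M \<in> set Ms \<Longrightarrow> invertible M"
  shows "invertible (mat_prod_list Ms)"
  using assms by (induction Ms) (auto simp: mat_prod_list_def invertible_mult invertible_def[of "mat 1"])

text \<open>Determinants carry invertibility from a power to its base and back.\<close>

lemma det_mat_pow: "det (mat_pow M k) = det M ^ k"
  by (induction k) (simp_all add: det_mul)

lemma complex_matrix_mult: "complex_matrix (M ** N) = complex_matrix M ** complex_matrix N"
  by (simp add: vec_eq_iff matrix_matrix_mult_def map_matrix_def)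

lemma complex_matrix_1: "complex_matrix (mat 1) = mat 1"
  by (simp add: vec_eq_iff mat_def map_matrix_def)

lemma invertible_complex_matrix: "invertible M \<Longrightarrow> invertible (complex_matrix M)"
  unfolding invertible_def by (metis complex_matrix_mult complex_matrix_1)

text \<open>\<open>matrix_inv\<close> is a Hilbert choice of a two-sided inverse; invertibility
  provides the witness.\<close>

lemma
  assumes "invertible M"
  shows matrix_inv_right: "M ** matrix_inv M = mat 1"
    and matrix_inv_left: "matrix_inv M ** M = mat 1"
  using someI_ex[OF assms[unfolded invertible_def]] by (auto simp: matrix_inv_def)

lemma matrix_mult_right_cancel:
  fixes M N C :: "'a::field ^ 'n ^ 'n"
  assumes "invertible C" and "M ** C = N ** C"
  shows "M = N"
  by (metis assms matrix_inv_right matrix_mul_assoc matrix_mul_rid)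

theorem theorem3:
  fixes A :: "nat ^ 'm \<Rightarrow> real ^ 'n ^ 'n"
    and Bt B P :: "nat ^ 'm \<Rightarrow> complex ^ 'n ^ 'n"
    and T :: nat
  assumes "CARD('m) \<ge> 2"
    and "\<And>t. invertible (A t)"
    and "T \<ge> 1"
    and "\<And>t. A (t + T *s 1) = A t"
    and "\<And>t. mat_pow (Bt t) T = complex_matrix (monodromy_matrix A T t)"
    and "\<And>t. B t = Bt (t - min_coord t *s 1)"
    and "\<And>t. complex_matrix (fundamental_matrix A t) = P t ** mat_pow (B t) (min_coord t)"
  shows "(\<forall>y. solves_recurrence B y \<longrightarrow>
            solves_recurrence (\<lambda>t. complex_matrix (A t)) (\<lambda>t. P t *v y t)) \<and>
         (\<forall>x. solves_recurrence (\<lambda>t. complex_matrix (A t)) x \<longrightarrow>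
            solves_recurrence B (\<lambda>t. matrix_inv (P t) *v x t))"
proof -
  \<comment> \<open>Both \<open>t\<close> and \<open>t + 1\<close> project to the same base point
    \<open>t - min_coord t *s 1\<close>.\<close>
  have B_plus_1: "B (t + 1) = B t" for t
    by (simp add: assms(6) min_coord_plus_1 plus_1_minus_Suc_smult_1)
  have "invertible (monodromy_matrix A T t)" for t
    unfolding monodromy_matrix_def by (intro invertible_mat_prod_list) (auto simp: assms(2))
  then have "det (mat_pow (Bt t) T) \<noteq> 0" for t
    by (simp add: assms(5) invertible_complex_matrix flip: invertible_det_nz)
  \<comment> \<open>A positive exponent matters: a zeroth power has determinant 1 whatever its
    base.\<close>
  then have det_B: "det (B t) \<noteq> 0" for t
    using \<open>T \<ge> 1\<close> by (simp add: assms(6) det_mat_pow)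
  have "invertible (fundamental_matrix A t)" for t
    unfolding fundamental_matrix_def by (intro invertible_mat_prod_list) (auto simp: assms(2))
  then have "det (P t ** mat_pow (B t) (min_coord t)) \<noteq> 0" for t
    by (simp add: invertible_complex_matrix flip: invertible_det_nz assms(7))
  \<comment> \<open>A left factor of a product with nonzero determinant has nonzero determinant
    itself.\<close>
  then have inv_P: "invertible (P t)" for t
    by (simp add: det_mul invertible_det_nz)
  have intertwine: "P (t + 1) ** B t = complex_matrix (A t) ** P t" for t
  proof (rule matrix_mult_right_cancel)
    show "invertible (mat_pow (B t) (min_coord t))"
      by (simp add: invertible_det_nz det_mat_pow det_B)
    \<comment> \<open>The extra \<open>B t\<close> raises the power to
      \<open>Suc (min_coord t)\<close>, which is the exponent that the factorization at
      \<open>t + 1\<close> asks for.\<close>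
    have "(P (t + 1) ** B t) ** mat_pow (B t) (min_coord t)
        = complex_matrix (fundamental_matrix A (t + 1))"
      by (simp add: assms(7) min_coord_plus_1 B_plus_1 matrix_mul_assoc)
    also have "\<dots> = (complex_matrix (A t) ** P t) ** mat_pow (B t) (min_coord t)"
      by (simp add: fundamental_matrix_plus_1 complex_matrix_mult assms(7) matrix_mul_assoc)
    finally show "(P (t + 1) ** B t) ** mat_pow (B t) (min_coord t)
        = (complex_matrix (A t) ** P t) ** mat_pow (B t) (min_coord t)" .
  qed
  show ?thesis
  proof (intro conjI allI impI)
    fix y assume "solves_recurrence B y"
    then show "solves_recurrence (\<lambda>t. complex_matrix (A t)) (\<lambda>t. P t *v y t)"
      by (simp add: solves_recurrence_def matrix_vector_mul_assoc intertwine)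
  next
    fix x assume x: "solves_recurrence (\<lambda>t. complex_matrix (A t)) x"
    have "matrix_inv (P (t + 1)) *v x (t + 1) = B t *v (matrix_inv (P t) *v x t)" for t
    proof -
      \<comment> \<open>Inserting \<open>P t ** matrix_inv (P t)\<close> on the right makes the
        intertwining relation applicable.\<close>
      have "matrix_inv (P (t + 1)) ** complex_matrix (A t)
          = matrix_inv (P (t + 1)) ** (complex_matrix (A t) ** P t) ** matrix_inv (P t)"
        by (simp add: matrix_inv_right inv_P flip: matrix_mul_assoc)
      also have "\<dots> = B t ** matrix_inv (P t)"
        by (simp add: matrix_inv_left inv_P matrix_mul_assoc flip: intertwine)
      finally show ?thesis
        using x by (simp add: solves_recurrence_def matrix_vector_mul_assoc)
    qed
    then show "solves_recurrence B (\<lambda>t. matrix_inv (P t) *v x t)"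
      by (simp add: solves_recurrence_def)
  qed
qed

end
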